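(* For every integer $d\geq 2$ we have $p_c(\mathbb{K}^d,\mathbb{Z}^d_{[2]})<1$.
   Context: Graphs are undirected. For graphs $G,H$ and $p\in[0,1]$, consider site percolation on $H$: each vertex of $H$ is open with probability $p$ and otherwise closed, independently for different vertices. An embedding of $G$ in the open set of $H$ is an injective map from the vertex set of $G$ to the set of open vertices of $H$ such that neighbours in $G$ map to neighbours in $H$. The critical probability is $$p_c(G,H):=\inf\bigl\{p\in[0,1]:\mathbb{P}(\text{there exists an embedding of } G \text{ in the open set of } H)>0\bigr\}.$$ For an integer $M\ge 1$, $\mathbb{Z}^d_{[M]}$ is the graph with vertex set $\mathbb{Z}^d$ in which $x,y$ are joined by an edge whenever $0<\|x-y\|_\infty\leq M$. The comb graph $\mathbb{K}^d$ has vertex set $\mathbb{Z}^d$ and edges $(z,z+e_i)$ for every $z\in\mathbb{Z}^d$ and all $1\leq i\leq d-1$, together with the edges $(z,z+e_d)$ for all $z\in\mathbb{Z}^d$ with $z_1=0$, where $e_1,\dots,e_d$ are the standard basis vectors. *)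

theory Defs
  imports "HOL-Probability.Probability"
begin

datatype 'a graph = Graph (verts: "'a set") (edges: "'a set set")

definition graph_embedding :: "'a graph \<Rightarrow> 'b graph \<Rightarrow> 'b set \<Rightarrow> ('a \<Rightarrow> 'b) \<Rightarrow> bool" where
  "graph_embedding G H S f \<longleftrightarrow>
     inj_on f (verts G) \<and> f ` verts G \<subseteq> S \<and>
     (\<forall>u\<in>verts G. \<forall>v\<in>verts G. {u, v} \<in> edges G \<longrightarrow> {f u, f v} \<in> edges H)"

(* The product measure is completed because the event that an embedding exists is an
   uncountable union over embeddings: for countable graphs it is analytic, hence always
   measurable for the completion, but not necessarily for the product sigma-algebra. *)
definition site_percolation :: "'b graph \<Rightarrow> real \<Rightarrow> ('b \<Rightarrow> bool) measure" where
  "site_percolation H p =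
     completion (\<Pi>\<^sub>M v\<in>verts H. measure_pmf (bernoulli_pmf p))"

definition open_set :: "'b graph \<Rightarrow> ('b \<Rightarrow> bool) \<Rightarrow> 'b set" where
  "open_set H \<omega> = {v \<in> verts H. \<omega> v}"

definition embedding_prob :: "'a graph \<Rightarrow> 'b graph \<Rightarrow> real \<Rightarrow> real" where
  "embedding_prob G H p =
     measure (site_percolation H p)
       {\<omega> \<in> space (site_percolation H p). \<exists>f. graph_embedding G H (open_set H \<omega>) f}"

(* Extended reals, so that the infimum of the empty set is infinity instead of an
   unspecified real. *)
definition critical_prob :: "'a graph \<Rightarrow> 'b graph \<Rightarrow> ereal" where
  "critical_prob G H = (INF p \<in> {p \<in> {0..1}. embedding_prob G H p > 0}. ereal p)"

(* Points have coordinates 1, ..., d; extensionality makes a point determined by them. *)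
definition int_lattice :: "nat \<Rightarrow> (nat \<Rightarrow> int) set" where
  "int_lattice d = {1..d} \<rightarrow>\<^sub>E UNIV"

(* Meaningful for d \<ge> 1 only. *)
definition linf_dist :: "nat \<Rightarrow> (nat \<Rightarrow> int) \<Rightarrow> (nat \<Rightarrow> int) \<Rightarrow> int" where
  "linf_dist d x y = (MAX i\<in>{1..d}. \<bar>x i - y i\<bar>)"

definition spread_out_lattice :: "nat \<Rightarrow> nat \<Rightarrow> (nat \<Rightarrow> int) graph" where
  "spread_out_lattice d M =
     Graph (int_lattice d)
       {{x, y} | x y. x \<in> int_lattice d \<and> y \<in> int_lattice d \<and>
                      0 < linf_dist d x y \<and> linf_dist d x y \<le> int M}"

definition add_unit :: "nat \<Rightarrow> (nat \<Rightarrow> int) \<Rightarrow> nat \<Rightarrow> int" where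
  "add_unit i z = z(i := z i + 1)"

definition comb_graph :: "nat \<Rightarrow> (nat \<Rightarrow> int) graph" where
  "comb_graph d =
     Graph (int_lattice d)
       ({{z, add_unit i z} | z i. z \<in> int_lattice d \<and> 1 \<le> i \<and> i < d} \<union>
        {{z, add_unit d z} | z. z \<in> int_lattice d \<and> z 1 = 0})"

end

theory Submission
  imports Defs
begin

text \<open>
  For \<open>p\<close> close to 1 the comb embeds almost surely, in the following shape. The vertices with
  last coordinate \<open>k\<close> form a layer, a copy of \<open>\<int>\<^bsup>d-1\<^esup>\<close>, which is mapped to the graph
  \<open>x\<^sub>d = L\<^sub>k(x\<^sub>1, \<dots>, x\<^bsub>d-1\<^esub>)\<close> of a 1-Lipschitz function whose graph is open, and \<open>L\<^sub>k < L\<^bsub>k+1\<^esub>\<close>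
  makes the layers disjoint. As in Lipschitz percolation, \<open>L\<^sub>k\<close> is the upper boundary of the
  set of points that can be reached by a path which goes down diagonally at will, goes up
  from closed sites, and goes up once more for each further layer (\<open>beneath\<close>).

  Away from \<open>z\<^sub>1 = 0\<close> successive layers need not be close to each other, but at \<open>z\<^sub>1 = 0\<close> they
  must be within distance 2. So the layers are pinned to a spine, a 1-Lipschitz graph
  \<open>x\<^sub>1 = S(x\<^sub>2, \<dots>, x\<^sub>d)\<close>: the paths start on the spine, and \<open>L\<^sub>k\<close> is required to pass through
  every spine point of height \<open>2k\<close>. The pinning fails at a spine point \<open>v\<close> only if a path from
  some spine point rises above \<open>v\<close>. Pins rise by 2 per layer but a path gains only 1 per
  layer, so most of its steps leave closed sites; hence there is an obstacle at \<open>v\<close>,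
  that is, a nonempty set of \<open>m\<close> closed sites visited by a walk of length \<open>2m\<close> from \<open>v\<close>
  (\<open>not_beneath_over_spine\<close>). It remains to find a spine without obstacles.

  The spine is again an upper boundary, now in the direction of the first coordinate, of the
  least set which contains a half-space, is closed under diagonal descent, and passes over
  every obstacle that it meets (\<open>pushed\<close>). The boundary exists if this set is not everything.
  The obstacles met on the way to a point \<open>v\<close> may overlap heavily, so their closed sites cannot
  be added up. A Vitali selection of disjoint obstacles, carried through the induction
  (\<open>pushed_route\<close>), still gives a walk of length at most \<open>36 m\<close> from \<open>v\<close> which visits
  \<open>m \<ge> v\<^sub>1 / 36\<close> closed sites (\<open>pushed_visits\<close>). There are at most \<open>2 (2 \<cdot> 3\<^sup>d)\<^bsup>36 m\<^esup>\<close> candidates for the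
  set of visited sites, each closed with probability \<open>(1 - p)\<^sup>m\<close>, so by a
  geometric union bound almost surely some point of the first axis is not pushed.

  Proving existence almost surely, and not just with positive probability, also settles the
  measurability of the event: its complement lies in a null set.
\<close>

section \<open>Walks in the lattice\<close>

definition near :: "nat \<Rightarrow> nat \<Rightarrow> (nat \<Rightarrow> int) \<Rightarrow> (nat \<Rightarrow> int) \<Rightarrow> bool" where
  "near d m u v \<longleftrightarrow> (\<forall>i\<in>{1..d}. \<bar>u i - v i\<bar> \<le> int m)"

lemma near_self [simp]: "near d m u u"
  by (simp add: near_def)

lemma near_commute: "near d m u v \<Longrightarrow> near d m v u"
  by (simp add: near_def abs_minus_commute)

lemma near_trans:
  assumes "near d m u v" "near d n v w"
  shows "near d (m + n) u w"
  unfolding near_def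
proof
  fix i assume "i \<in> {1..d}"
  then have "\<bar>u i - v i\<bar> \<le> int m" "\<bar>v i - w i\<bar> \<le> int n"
    using assms by (auto simp: near_def)
  then show "\<bar>u i - w i\<bar> \<le> int (m + n)" by linarith
qed

lemma near_mono: "near d m u v \<Longrightarrow> m \<le> n \<Longrightarrow> near d n u v"
  unfolding near_def by fastforce

lemma near_add_unit: "near d 1 u (add_unit i u)"
  by (simp add: near_def add_unit_def)

lemma lattice_upd [simp]: "u \<in> int_lattice d \<Longrightarrow> i \<in> {1..d} \<Longrightarrow> u(i := a) \<in> int_lattice d"
  unfolding int_lattice_def PiE_def extensional_def by auto

lemma lattice_add_unit [simp]:
  "u \<in> int_lattice d \<Longrightarrow> i \<in> {1..d} \<Longrightarrow> add_unit i u \<in> int_lattice d"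
  by (simp add: add_unit_def)

lemma lattice_eqI:
  "u \<in> int_lattice d \<Longrightarrow> v \<in> int_lattice d \<Longrightarrow> (\<And>i. i \<in> {1..d} \<Longrightarrow> u i = v i) \<Longrightarrow> u = v"
  unfolding int_lattice_def by (rule PiE_ext)

lemma near_0_eq: "u \<in> int_lattice d \<Longrightarrow> v \<in> int_lattice d \<Longrightarrow> near d 0 u v \<Longrightarrow> u = v"
  by (rule lattice_eqI) (auto simp: near_def)

definition step_towards :: "nat \<Rightarrow> (nat \<Rightarrow> int) \<Rightarrow> (nat \<Rightarrow> int) \<Rightarrow> nat \<Rightarrow> int" where
  "step_towards d u v = (\<lambda>i\<in>{1..d}. u i + sgn (v i - u i))"

lemma step_towards_lattice [simp]: "step_towards d u v \<in> int_lattice d"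
  by (simp add: step_towards_def int_lattice_def)

lemma near_step_towards: "near d 1 u (step_towards d u v)"
  by (auto simp: near_def step_towards_def sgn_if)

lemma step_towards_near: "near d (Suc m) u v \<Longrightarrow> near d m (step_towards d u v) v"
  unfolding near_def step_towards_def by (auto simp: sgn_if)

text \<open>
  \<open>visits d v l Q e\<close>: some walk of \<open>l\<close> steps from \<open>v\<close> to \<open>e\<close> visits every point of \<open>Q\<close>. It may
  visit other points too, and its steps may stay put, so that a bound on the length can
  be used as the length.
\<close>

inductive visits :: "nat \<Rightarrow> (nat \<Rightarrow> int) \<Rightarrow> nat \<Rightarrow> (nat \<Rightarrow> int) set \<Rightarrow> (nat \<Rightarrow> int) \<Rightarrow> bool"
  for d where
  visits_stay: "v \<in> int_lattice d \<Longrightarrow> Q \<subseteq> {v} \<Longrightarrow> visits d v 0 Q v"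
| visits_step: "v \<in> int_lattice d \<Longrightarrow> near d 1 v w \<Longrightarrow> visits d w l Q e \<Longrightarrow> Q' \<subseteq> insert v Q
    \<Longrightarrow> visits d v (Suc l) Q' e"

lemma visits_start: "visits d v l Q e \<Longrightarrow> v \<in> int_lattice d"
  by (induction rule: visits.induct) auto

lemma visits_end: "visits d v l Q e \<Longrightarrow> e \<in> int_lattice d"
  by (induction rule: visits.induct) auto

lemma visits_finite: "visits d v l Q e \<Longrightarrow> finite Q"
  by (induction rule: visits.induct) (use finite_subset in blast)+

lemma visits_near_end: "visits d v l Q e \<Longrightarrow> near d l v e"
proof (induction rule: visits.induct)
  case (visits_step v w l Q e Q')
  from near_trans[OF visits_step(2) visits_step.IH] show ?case by simp
qed simp

lemma visits_near: "visits d v l Q e \<Longrightarrow> q \<in> Q \<Longrightarrow> near d l v q"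
proof (induction arbitrary: q rule: visits.induct)
  case (visits_step v w l Q e Q')
  show ?case
  proof (cases "q = v")
    case False
    then have "near d l w q" using visits_step by blast
    from near_trans[OF visits_step(2) this] show ?thesis by simp
  qed simp
qed auto

lemma visits_insert_start:
  assumes "visits d v l Q e" "Q' \<subseteq> insert v Q"
  shows "visits d v l Q' e"
  using assms(1)
proof cases
  case visits_stay
  then show ?thesis using assms(2) by (auto intro: visits.visits_stay)
next
  case (visits_step w l' P)
  then have "Q' \<subseteq> insert v P" using assms(2) by blast
  then show ?thesis using visits_step visits.visits_step by blast
qed

lemma visits_append:
  "visits d v l Q e \<Longrightarrow> visits d e l' Q' e' \<Longrightarrow> visits d v (l + l') (Q \<union> Q') e'"
proof (induction rule: visits.induct)
  case (visits_stay v Q)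
  then have "Q \<union> Q' \<subseteq> insert v Q'" by blast
  with visits_stay show ?case using visits_insert_start by simp
next
  case (visits_step v w l Q e Q1)
  then have "visits d v (Suc (l + l')) (Q1 \<union> Q') e'"
    by (intro visits.visits_step[OF visits_step(1,2)]) auto
  then show ?case by simp
qed

lemma visits_straight:
  "u \<in> int_lattice d \<Longrightarrow> v \<in> int_lattice d \<Longrightarrow> near d m u v \<Longrightarrow> visits d u m {} v"
proof (induction m arbitrary: u)
  case 0
  then show ?case using near_0_eq visits_stay by blast
next
  case (Suc m)
  then have "visits d (step_towards d u v) m {} v"
    by (metis step_towards_lattice step_towards_near)
  then show ?case
    using visits_step[OF Suc.prems(1) near_step_towards] by blast
qed

lemma visits_longer:
  assumes "visits d v l Q e" "l \<le> l'"
  shows "visits d v l' Q e"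
proof -
  have "visits d e (l' - l) {} e"
    using visits_end[OF assms(1)] by (intro visits_straight) auto
  from visits_append[OF assms(1) this] show ?thesis using assms(2) by simp
qed

lemma visits_join:
  assumes "visits d v l Q e" "near d m e w" "visits d w l' Q' e'"
  shows "visits d v (l + m + l') (Q \<union> Q') e'"
  using visits_append[OF visits_append[OF assms(1) visits_straight[OF _ _ assms(2)]] assms(3)]
    visits_end[OF assms(1)] visits_start[OF assms(3)] by simp

text \<open>
  A finite family that contains every \<open>Q\<close> with \<open>visits d v l Q e\<close>: at each of its points a walk chooses
  the next point and whether to record the current one, which gives the bound of
  \<open>card_visitable\<close>.
\<close>

primrec visitable :: "nat \<Rightarrow> nat \<Rightarrow> (nat \<Rightarrow> int) \<Rightarrow> (nat \<Rightarrow> int) set set" where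
  "visitable d 0 v = {{}, {v}}"
| "visitable d (Suc l) v =
     (\<Union>w\<in>{w \<in> int_lattice d. near d 1 v w}. visitable d l w \<union> insert v ` visitable d l w)"

lemma visits_visitable: "visits d v l Q e \<Longrightarrow> P \<subseteq> Q \<Longrightarrow> P \<in> visitable d l v"
proof (induction arbitrary: P rule: visits.induct)
  case (visits_step v w l Q e Q')
  have "P - {v} \<in> visitable d l w"
    using visits_step.prems visits_step.hyps(4) by (intro visits_step.IH) auto
  then have "P \<in> visitable d l w \<union> insert v ` visitable d l w"
    by (cases "v \<in> P") (simp_all add: rev_image_eqI[of "P - {v}"] insert_absorb)
  moreover have "w \<in> {w \<in> int_lattice d. near d 1 v w}"
    using visits_step.hyps(2) visits_start[OF visits_step.hyps(3)] by simp
  ultimately show ?case unfolding visitable.simps by (rule UN_I[rotated])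
next
  case (visits_stay v Q)
  then have "P = {} \<or> P = {v}" by blast
  then show ?case by simp
qed

lemma card_neighbours:
  "finite {w \<in> int_lattice d. near d 1 v w} \<and> card {w \<in> int_lattice d. near d 1 v w} \<le> 3 ^ d"
proof -
  have "{w \<in> int_lattice d. near d 1 v w} = (\<Pi>\<^sub>E i\<in>{1..d}. {v i - 1..v i + 1})" (is "?N = ?B")
  proof (intro set_eqI iffI)
    fix w assume "w \<in> ?N"
    then have w: "w \<in> extensional {1..d}" and near: "\<forall>i\<in>{1..d}. \<bar>v i - w i\<bar> \<le> int 1"
      by (simp_all add: int_lattice_def near_def PiE_def)
    have "w i \<in> {v i - 1..v i + 1}" if "i \<in> {1..d}" for i
      using bspec[OF near that] by auto
    then show "w \<in> ?B" using w by (simp add: PiE_def Pi_def)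
  next
    fix w assume w: "w \<in> ?B"
    have "\<bar>v i - w i\<bar> \<le> int 1" if "i \<in> {1..d}" for i
      using PiE_mem[OF w that] by auto
    then show "w \<in> ?N" using w by (simp add: int_lattice_def near_def PiE_def)
  qed
  moreover have "card (\<Pi>\<^sub>E i\<in>{1..d}. {v i - 1..v i + 1}) = 3 ^ d"
    by (subst card_PiE) auto
  ultimately show ?thesis by (simp add: finite_PiE)
qed

lemma card_visitable:
  "finite (visitable d l v) \<and> card (visitable d l v) \<le> 2 * (2 * 3 ^ d) ^ l"
proof (induction l arbitrary: v)
  case 0
  show ?case by (simp add: card_insert_if)
next
  case (Suc l)
  let ?N = "{w \<in> int_lattice d. near d 1 v w}"
  let ?F = "\<lambda>w. visitable d l w \<union> insert v ` visitable d l w"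
  have F: "card (?F w) \<le> 2 * (2 * (2 * 3 ^ d) ^ l)" for w
    using card_Un_le[of "visitable d l w" "insert v ` visitable d l w"]
      card_image_le[of "visitable d l w" "insert v"] Suc[of w] by linarith
  have "card (\<Union>w\<in>?N. ?F w) \<le> (\<Sum>w\<in>?N. card (?F w))"
    using card_neighbours by (intro card_UN_le) auto
  also have "\<dots> \<le> card ?N * (2 * (2 * (2 * 3 ^ d) ^ l))"
    using sum_bounded_above[of ?N "\<lambda>w. card (?F w)"] F by simp
  also have "\<dots> \<le> 3 ^ d * (2 * (2 * (2 * 3 ^ d) ^ l))"
    using card_neighbours by (intro mult_right_mono) auto
  also have "\<dots> = 2 * (2 * 3 ^ d) ^ Suc l"
    by simp
  finally have "card (visitable d (Suc l) v) \<le> 2 * (2 * 3 ^ d) ^ Suc l"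
    by (simp only: visitable.simps)
  moreover have "finite (visitable d (Suc l) v)"
    unfolding visitable.simps using card_neighbours Suc by blast
  ultimately show ?case by blast
qed

section \<open>Obstacles and the region they push up\<close>

locale closed_sites =
  fixes d :: nat and Cl :: "(nat \<Rightarrow> int) set"
  assumes d_ge_2: "2 \<le> d"
begin

lemma d_index: "1 \<in> {1..d}" "d \<in> {1..d}" "d \<noteq> 1"
  using d_ge_2 by auto

lemma add_unit_lattice [simp]:
  "v \<in> int_lattice d \<Longrightarrow> add_unit (Suc 0) v \<in> int_lattice d"
  "v \<in> int_lattice d \<Longrightarrow> add_unit d v \<in> int_lattice d"
  using d_index by auto

text \<open>
  The number \<open>2 * card Q\<close> also serves as the radius of the obstacle: \<open>Q\<close> lies within this
  distance of \<open>v\<close>.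
\<close>

definition obstacle :: "(nat \<Rightarrow> int) \<Rightarrow> (nat \<Rightarrow> int) set \<Rightarrow> bool" where
  "obstacle v Q \<longleftrightarrow> Q \<noteq> {} \<and> Q \<subseteq> Cl \<and> (\<exists>e. visits d v (2 * card Q) Q e)"

text \<open>
  The points \<open>v\<close> that can be reached from \<open>u\<close> by steps that lower coordinate \<open>j\<close> by one and
  change every other coordinate by at most one.
\<close>

definition cone :: "nat \<Rightarrow> (nat \<Rightarrow> int) \<Rightarrow> (nat \<Rightarrow> int) \<Rightarrow> bool" where
  "cone j u v \<longleftrightarrow> (\<forall>i\<in>{1..d}. \<bar>u i - v i\<bar> \<le> u j - v j)"

lemma cone_near: "cone j u v \<Longrightarrow> near d (nat (u j - v j)) u v"
  unfolding cone_def near_def by fastforce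

lemma cone_le: "cone j u v \<Longrightarrow> v j \<le> u j"
  using d_index(2) unfolding cone_def by fastforce

lemma int_last_true:
  fixes P :: "int \<Rightarrow> bool"
  assumes "P a" "\<not> P b" "a \<le> b"
  shows "\<exists>s. P s \<and> \<not> P (s + 1)"
proof (rule ccontr)
  assume no: "\<nexists>s. P s \<and> \<not> P (s + 1)"
  from assms(3) have "P b"
    by (induction b rule: int_ge_induct) (use assms(1) no in auto)
  then show False using assms(2) by blast
qed

text \<open>
  The upper boundary of a set that contains the cone below each of its points is a 1-Lipschitz
  graph: if \<open>u\<close> were too high, the point just above \<open>v\<close> would be in the cone below \<open>u\<close>. Both the
  spine and the layers get their Lipschitz property from here.
\<close>

lemma cone_closed_top_le:
  assumes closed: "\<And>u v. P u \<Longrightarrow> v \<in> int_lattice d \<Longrightarrow> cone j u v \<Longrightarrow> P v"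
    and "P u" "\<not> P (add_unit j v)" "v \<in> int_lattice d" "j \<in> {1..d}" "0 \<le> m"
    and near: "\<And>i. i \<in> {1..d} \<Longrightarrow> i \<noteq> j \<Longrightarrow> \<bar>u i - v i\<bar> \<le> m"
  shows "u j \<le> v j + m"
proof (rule ccontr)
  assume "\<not> u j \<le> v j + m"
  then have "cone j u (add_unit j v)"
    using near \<open>0 \<le> m\<close> unfolding cone_def add_unit_def by fastforce
  then show False using assms(2-5) closed by simp
qed

lemma cone_closed_top_lipschitz:
  assumes closed: "\<And>u v. P u \<Longrightarrow> v \<in> int_lattice d \<Longrightarrow> cone j u v \<Longrightarrow> P v"
    and top: "P u \<and> \<not> P (add_unit j u)" "P v \<and> \<not> P (add_unit j v)"
    and lattice: "u \<in> int_lattice d" "v \<in> int_lattice d" "j \<in> {1..d}" "0 \<le> m"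
    and near: "\<And>i. i \<in> {1..d} \<Longrightarrow> i \<noteq> j \<Longrightarrow> \<bar>u i - v i\<bar> \<le> m"
  shows "\<bar>u j - v j\<bar> \<le> m"
proof -
  have "u j \<le> v j + m"
    by (rule cone_closed_top_le[of P j u v m, OF closed]) (use top lattice near in simp_all)
  moreover have "v j \<le> u j + m"
    by (rule cone_closed_top_le[of P j v u m, OF closed])
      (use top lattice near in \<open>simp_all add: abs_minus_commute\<close>)
  ultimately show ?thesis by simp
qed

inductive pushed :: "(nat \<Rightarrow> int) \<Rightarrow> bool" where
  pushed_base: "v \<in> int_lattice d \<Longrightarrow> v 1 \<le> 0 \<Longrightarrow> pushed v"
| pushed_cone: "pushed v \<Longrightarrow> u \<in> int_lattice d \<Longrightarrow> cone 1 v u \<Longrightarrow> pushed u"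
| pushed_over: "pushed v \<Longrightarrow> obstacle v Q \<Longrightarrow> pushed (add_unit 1 v)"

lemma pushed_lattice: "pushed v \<Longrightarrow> v \<in> int_lattice d"
  by (induction rule: pushed.induct) auto

text \<open>
  A record of how a point was pushed. Between descents the route jumps within balls of four
  times the radius of an obstacle around its starting point \<open>c\<close>; the list shows the
  latest obstacle first. The factor four leaves room to let one obstacle stand for smaller ones
  that it touches.
\<close>

inductive route :: "((nat \<Rightarrow> int) \<times> (nat \<Rightarrow> int) set) list \<Rightarrow> (nat \<Rightarrow> int) \<Rightarrow> bool" where
  route_base: "v \<in> int_lattice d \<Longrightarrow> v 1 \<le> 0 \<Longrightarrow> route [] v"
| route_cone: "route bs v \<Longrightarrow> u \<in> int_lattice d \<Longrightarrow> cone 1 v u \<Longrightarrow> route bs u"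
| route_jump: "route bs a \<Longrightarrow> obstacle c Q \<Longrightarrow> near d (8 * card Q) c a \<Longrightarrow>
    near d (8 * card Q) c b \<Longrightarrow> b \<in> int_lattice d \<Longrightarrow> route ((c, Q) # bs) b"

abbreviation disjoint_obstacles :: "((nat \<Rightarrow> int) \<times> (nat \<Rightarrow> int) set) list \<Rightarrow> bool" where
  "disjoint_obstacles \<equiv> sorted_wrt (\<lambda>x y. snd x \<inter> snd y = {})"

lemma route_suffix:
  "route (xs @ (c, Q) # ys) v \<Longrightarrow> obstacle c Q \<and> (\<exists>a. route ys a \<and> near d (8 * card Q) c a)"
proof (induction "xs @ (c, Q) # ys" v arbitrary: xs rule: route.induct)
  case (route_jump bs a c' Q' b)
  show ?case
  proof (cases xs)
    case Nil
    then show ?thesis using route_jump by auto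
  next
    case (Cons x xs')
    then have "bs = xs' @ (c, Q) # ys" using route_jump(7) by simp
    from route_jump(2)[OF this] show ?thesis .
  qed
qed auto

lemma obstacle_card_pos: "obstacle v Q \<Longrightarrow> 0 < card Q"
  unfolding obstacle_def using visits_finite by (auto simp: card_gt_0_iff)

lemma obstacle_near: "obstacle v Q \<Longrightarrow> q \<in> Q \<Longrightarrow> near d (2 * card Q) v q"
  unfolding obstacle_def using visits_near by blast

text \<open>
  This is Vitali's covering argument, done one obstacle at a time. If the new obstacle is
  disjoint from the recorded ones, it is added. Otherwise let \<open>(c, Q)\<close> be the earliest recorded
  obstacle that it touches. Everything after \<open>Q\<close> is forgotten, and the larger of the two (up to a
  factor of two) takes over the whole jump: \<open>Q\<close> if the new radius is at most twice the old one,
  since then the new point is within \<open>1 + 2 + 1\<close> old radii of \<open>c\<close>, and the new obstacle otherwise,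
  since then the entry point of the old ball is within \<open>1 + 5/2 < 4\<close> new radii. What was recorded
  before \<open>Q\<close> is disjoint from the new obstacle because \<open>Q\<close> is the earliest one touched.
\<close>

lemma pushed_route: "pushed v \<Longrightarrow> \<exists>bs. route bs v \<and> disjoint_obstacles bs"
proof (induction rule: pushed.induct)
  case (pushed_base v)
  then show ?case using route_base by fastforce
next
  case (pushed_cone v u)
  then show ?case using route_cone by blast
next
  case (pushed_over v Q')
  then obtain bs where bs: "route bs v" "disjoint_obstacles bs" by blast
  let ?b = "add_unit 1 v"
  have b: "?b \<in> int_lattice d"
    using pushed_lattice[OF pushed_over(1)] by simp
  have pos: "0 < card Q'" by (rule obstacle_card_pos) fact
  have b_near: "near d (8 * card Q') v ?b"
    by (rule near_mono[OF near_add_unit]) (use pos in simp)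
  show ?case
  proof (cases "\<exists>x\<in>set bs. snd x \<inter> Q' \<noteq> {}")
    case False
    have "route ((v, Q') # bs) ?b"
      by (rule route_jump[OF bs(1) pushed_over(2) near_self b_near b])
    moreover have "disjoint_obstacles ((v, Q') # bs)" using False bs(2) by auto
    ultimately show ?thesis by blast
  next
    case True
    \<comment> \<open>The list runs backwards in time, so its last element touching \<open>Q'\<close> is the earliest.\<close>
    obtain xs x ys where split: "bs = xs @ x # ys" "snd x \<inter> Q' \<noteq> {}" "\<forall>y\<in>set ys. snd y \<inter> Q' = {}"
      using split_list_last_prop[OF True] by metis
    obtain c Q where x: "x = (c, Q)" by (cases x)
    obtain q where q: "q \<in> Q" "q \<in> Q'" using split(2) x by auto
    obtain a where cQ: "obstacle c Q" and a: "route ys a" "near d (8 * card Q) c a"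
      using route_suffix[of xs c Q ys v] bs(1) split(1) x by auto
    have cv: "near d (2 * card Q + 2 * card Q') c v"
      by (rule near_trans[OF obstacle_near[OF cQ q(1)]])
         (rule near_commute[OF obstacle_near[OF pushed_over(2) q(2)]])
    have disj: "disjoint_obstacles (x # ys)" using bs(2) split(1) by (simp add: sorted_wrt_append)
    show ?thesis
    proof (cases "card Q' \<le> 2 * card Q")
      case True
      have "near d (2 * card Q + 2 * card Q' + 1) c ?b"
        by (rule near_trans[OF cv near_add_unit])
      then have "near d (8 * card Q) c ?b"
        by (rule near_mono) (use True obstacle_card_pos[OF cQ] in linarith)
      from route_jump[OF a(1) cQ a(2) this b] disj x show ?thesis by blast
    next
      case False
      have "near d (2 * card Q + 2 * card Q' + 8 * card Q) v a"
        by (rule near_trans[OF near_commute[OF cv] a(2)])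
      then have "near d (8 * card Q') v a"
        by (rule near_mono) (use False in linarith)
      from route_jump[OF a(1) pushed_over(2) this b_near b]
      have "route ((v, Q') # ys) ?b" .
      moreover have "disjoint_obstacles ((v, Q') # ys)" using split(3) disj by auto
      ultimately show ?thesis by blast
    qed
  qed
qed

text \<open>
  Walk back along the route, with a detour through each obstacle. A descent adds as much to
  the length as it takes from the first coordinate. For an obstacle with \<open>n\<close> points, \<open>20 n\<close> steps
  suffice: \<open>8 n\<close> to its starting point, \<open>2 n\<close> to visit it, \<open>2 n\<close> to return and \<open>8 n\<close> to the entry
  point; and its jump raises the first coordinate by at most \<open>16 n\<close>. Hence the constant 36.
  Disjointness lets the points of the obstacles add up.
\<close>

lemma route_visits:
  "route bs v \<Longrightarrow> disjoint_obstacles bs \<Longrightarrow>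
   \<exists>Q l e. visits d v l Q e \<and> Q \<subseteq> Cl \<and> Q = \<Union> (snd ` set bs) \<and> int l + v 1 \<le> 36 * int (card Q)"
proof (induction rule: route.induct)
  case (route_base v)
  then show ?case using visits_stay[of v d "{}"] by fastforce
next
  case (route_cone bs v u)
  then obtain Q l e where Q: "visits d v l Q e" "Q \<subseteq> Cl" "Q = \<Union> (snd ` set bs)"
    "int l + v 1 \<le> 36 * int (card Q)" by blast
  have "visits d u (nat (v 1 - u 1)) {} v"
    using route_cone Q(1) visits_start by (intro visits_straight near_commute[OF cone_near]) auto
  from visits_append[OF this Q(1)] have "visits d u (nat (v 1 - u 1) + l) Q e" by simp
  moreover have "int (nat (v 1 - u 1) + l) + u 1 \<le> 36 * int (card Q)"
    using Q(4) cone_le[OF route_cone(3)] by simp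
  ultimately show ?case using Q by blast
next
  case (route_jump bs a c Q' b)
  then obtain Q l e where Q: "visits d a l Q e" "Q \<subseteq> Cl" "Q = \<Union> (snd ` set bs)"
    "int l + a 1 \<le> 36 * int (card Q)" by auto
  let ?n = "card Q'"
  obtain e' where Q': "Q' \<subseteq> Cl" "visits d c (2 * ?n) Q' e'"
    using route_jump(2) unfolding obstacle_def by blast
  have "near d (2 * ?n + 8 * ?n) e' a"
    by (rule near_trans[OF near_commute[OF visits_near_end[OF Q'(2)]]]) fact
  from visits_join[OF Q'(2) this Q(1)]
  have "visits d c (2 * ?n + (2 * ?n + 8 * ?n) + l) (Q' \<union> Q) e" .
  from visits_join[OF visits_stay[of b d "{}"] near_commute[OF route_jump(4)] this]
  have "visits d b (20 * ?n + l) (Q' \<union> Q) e" using route_jump(5) by simp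
  moreover have "card (Q' \<union> Q) = ?n + card Q"
    using visits_finite[OF Q'(2)] visits_finite[OF Q(1)] route_jump(7) Q(3)
    by (intro card_Un_disjoint) auto
  moreover have "\<bar>c 1 - a 1\<bar> \<le> int (8 * ?n)" "\<bar>c 1 - b 1\<bar> \<le> int (8 * ?n)"
    using route_jump(3,4) d_index(1) unfolding near_def by auto
  then have "b 1 \<le> a 1 + 16 * int ?n" by linarith
  ultimately have "visits d b (20 * ?n + l) (Q' \<union> Q) e \<and> Q' \<union> Q \<subseteq> Cl \<and>
      Q' \<union> Q = \<Union> (snd ` set ((c, Q') # bs)) \<and>
      int (20 * ?n + l) + b 1 \<le> 36 * int (card (Q' \<union> Q))"
    using Q Q' by simp
  then show ?case by blast
qed

lemma pushed_visits:
  assumes "pushed v"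
  shows "\<exists>Q l e. visits d v l Q e \<and> Q \<subseteq> Cl \<and> int l + v 1 \<le> 36 * int (card Q)"
  using pushed_route[OF assms] route_visits by blast

end

section \<open>The spine\<close>

locale bounded_push = closed_sites +
  assumes unpushed: "\<exists>v\<in>int_lattice d. \<not> pushed v"
begin

definition spine_point :: "(nat \<Rightarrow> int) \<Rightarrow> bool" where
  "spine_point v \<longleftrightarrow> pushed v \<and> \<not> pushed (add_unit 1 v)"

lemma spine_point_lattice: "spine_point v \<Longrightarrow> v \<in> int_lattice d"
  by (simp add: spine_point_def pushed_lattice)

text \<open>
  The pushed set would pass over an obstacle, so there is none on its boundary.
\<close>

lemma spine_point_no_obstacle: "spine_point v \<Longrightarrow> \<not> obstacle v Q"
  unfolding spine_point_def using pushed_over by blast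

text \<open>
  One unpushed point suffices for all columns, because a pushed point far enough out
  in any column would have it in the cone below.
\<close>

lemma column_unpushed:
  assumes "z \<in> int_lattice d"
  shows "\<exists>n. \<not> pushed (z(1 := n))"
proof -
  obtain v where v: "v \<in> int_lattice d" "\<not> pushed v" using unpushed by blast
  define m where "m = (\<Sum>i\<in>{1..d}. \<bar>v i - z i\<bar>)"
  have m: "\<bar>v i - z i\<bar> \<le> m" if "i \<in> {1..d}" for i
    unfolding m_def using that by (intro member_le_sum) auto
  have "0 \<le> m" unfolding m_def by (intro sum_nonneg) auto
  then have "cone 1 (z(1 := v 1 + m)) v"
    using m unfolding cone_def by (auto simp: abs_minus_commute)
  then have "\<not> pushed (z(1 := v 1 + m))"
    using v pushed_cone by blast
  then show ?thesis by blast
qed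

lemma spine_exists:
  assumes z: "z \<in> int_lattice d"
  shows "\<exists>s. spine_point (z(1 := s))"
proof -
  obtain b where b: "\<not> pushed (z(1 := b))" using column_unpushed[OF z] by blast
  have "pushed (z(1 := min 0 b))"
    using z d_index(1) by (intro pushed_base) auto
  from int_last_true[of "\<lambda>s. pushed (z(1 := s))", OF this b] show ?thesis
    unfolding spine_point_def add_unit_def by simp
qed

definition spine :: "(nat \<Rightarrow> int) \<Rightarrow> nat \<Rightarrow> int" where
  "spine z = z(1 := (SOME s. spine_point (z(1 := s))))"

lemma spine_point_spine: "z \<in> int_lattice d \<Longrightarrow> spine_point (spine z)"
  unfolding spine_def by (rule someI_ex[OF spine_exists])

lemma spine_other [simp]: "i \<noteq> 1 \<Longrightarrow> spine z i = z i"
  by (simp add: spine_def)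

lemma spine_lipschitz:
  assumes "spine_point u" "spine_point v" "0 \<le> m"
    and near: "\<And>i. i \<in> {1..d} \<Longrightarrow> i \<noteq> 1 \<Longrightarrow> \<bar>u i - v i\<bar> \<le> m"
  shows "\<bar>u 1 - v 1\<bar> \<le> m"
proof (rule cone_closed_top_lipschitz[of pushed])
  show "pushed u \<and> \<not> pushed (add_unit 1 u)" "pushed v \<and> \<not> pushed (add_unit 1 v)"
    using assms(1,2) unfolding spine_point_def by blast+
qed (fact pushed_cone spine_point_lattice[OF assms(1)] spine_point_lattice[OF assms(2)]
    d_index(1) assms(3) near)+

section \<open>The layers\<close>

text \<open>
  The points on or below layer \<open>k\<close>. Each rule after the first enforces one property of the upper
  boundary: \<open>beneath_down\<close> makes it Lipschitz, \<open>beneath_closed\<close> makes it open, and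
  \<open>beneath_next\<close> makes the layers strictly increasing.
\<close>

inductive beneath :: "int \<Rightarrow> (nat \<Rightarrow> int) \<Rightarrow> bool" where
  beneath_spine: "spine_point w \<Longrightarrow> w d = 2 * k \<Longrightarrow> beneath k w"
| beneath_down: "beneath k u \<Longrightarrow> v \<in> int_lattice d \<Longrightarrow> near d 1 u v \<Longrightarrow> v d = u d - 1 \<Longrightarrow> beneath k v"
| beneath_closed: "beneath k u \<Longrightarrow> u \<in> Cl \<Longrightarrow> beneath k (add_unit d u)"
| beneath_next: "beneath k u \<Longrightarrow> beneath (k + 1) (add_unit d u)"

text \<open>
  A derivation of \<open>beneath\<close> as the list of points passed, latest first: \<open>Q\<close> collects the closed
  sites left upwards, and \<open>D\<close> and \<open>K\<close> count the steps down and the changes of layer.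
\<close>

inductive ascent :: "(nat \<Rightarrow> int) list \<Rightarrow> (nat \<Rightarrow> int) set \<Rightarrow> nat \<Rightarrow> nat \<Rightarrow> bool" where
  ascent_start: "w \<in> int_lattice d \<Longrightarrow> ascent [w] {} 0 0"
| ascent_down: "ascent (u # p) Q D K \<Longrightarrow> v \<in> int_lattice d \<Longrightarrow> near d 1 u v \<Longrightarrow> v d = u d - 1
    \<Longrightarrow> ascent (v # u # p) Q (D + 1) K"
| ascent_closed: "ascent (u # p) Q D K \<Longrightarrow> u \<in> Cl \<Longrightarrow> ascent (add_unit d u # u # p) (insert u Q) D K"
| ascent_next: "ascent (u # p) Q D K \<Longrightarrow> ascent (add_unit d u # u # p) Q D (K + 1)"

lemma ascent_suffix:
  "ascent (xs @ y # ys) Q D K \<Longrightarrow> \<exists>Q' D' K'. ascent (y # ys) Q' D' K' \<and> K' \<le> K"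
proof (induction xs arbitrary: Q D K)
  case (Cons x xs)
  from Cons.prems obtain Q1 D1 K1 where "ascent (xs @ y # ys) Q1 D1 K1" "K1 \<le> K"
    by (cases rule: ascent.cases) auto
  with Cons.IH show ?case by (meson order_trans)
qed auto

text \<open>
  On a path without repetitions different upward steps out of closed sites use different sites,
  so their number is \<open>card Q\<close>.
\<close>

lemma ascent_distinct:
  "ascent p Q D K \<Longrightarrow> distinct p \<Longrightarrow>
    Q \<subseteq> Cl \<and> Q \<subseteq> set (tl p) \<and> hd p d - last p d = int (card Q) + int K - int D \<and>
    (\<exists>e. visits d (hd p) (card Q + K + D) Q e)"
proof (induction rule: ascent.induct)
  case (ascent_start w)
  then show ?case using visits_stay by fastforce
next
  case (ascent_down u p Q D K v)
  then obtain e where "visits d u (card Q + K + D) Q e" by auto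
  from visits_step[OF ascent_down(2) near_commute[OF ascent_down(3)] this, of Q]
  have "visits d v (card Q + K + (D + 1)) Q e" by auto
  then show ?case using ascent_down by (auto simp: fun_upd_def)
next
  case (ascent_closed u p Q D K)
  then obtain e where e: "visits d u (card Q + K + D) Q e" and Q: "Q \<subseteq> set p" by auto
  have fresh: "card (insert u Q) = Suc (card Q)"
    using visits_finite[OF e] Q ascent_closed by (subst card_insert_disjoint) auto
  have "visits d u (card Q + K + D) (insert u Q) e"
    by (rule visits_insert_start[OF e]) simp
  from visits_step[OF _ near_commute[OF near_add_unit] this, of d "insert u Q"]
  have "visits d (add_unit d u) (card (insert u Q) + K + D) (insert u Q) e"
    using fresh visits_start[OF e] by auto
  moreover have "add_unit d u d = u d + 1" by (simp add: add_unit_def)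
  ultimately show ?case using ascent_closed fresh by auto
next
  case (ascent_next u p Q D K)
  then obtain e where e: "visits d u (card Q + K + D) Q e" by auto
  from visits_step[OF _ near_commute[OF near_add_unit] this, of d Q]
  have "visits d (add_unit d u) (card Q + (K + 1) + D) Q e"
    using visits_start[OF e] by auto
  moreover have "add_unit d u d = u d + 1" by (simp add: add_unit_def)
  ultimately show ?case using ascent_next by auto
qed

definition reached :: "int \<Rightarrow> (nat \<Rightarrow> int) \<Rightarrow> bool" where
  "reached k u \<longleftrightarrow> (\<exists>p Q D K j. ascent (u # p) Q D K \<and> distinct (u # p) \<and>
     spine_point (last (u # p)) \<and> last (u # p) d = 2 * j \<and> j + int K \<le> k)"

text \<open>
  If \<open>v\<close> is already on the path, the path is cut off at the earlier visit to \<open>v\<close>. That visit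
  happened in no later layer; this is why \<open>reached\<close> has an inequality between the layers.
\<close>

lemma reached_extend:
  assumes "ascent (v # u # p) Q D K" "distinct (u # p)" "spine_point (last (u # p))"
    "last (u # p) d = 2 * j" "j + int K \<le> k"
  shows "reached k v"
proof (cases "v \<in> set (u # p)")
  case False
  then show ?thesis unfolding reached_def using assms
    by (intro exI[of _ "u # p"] exI[of _ Q] exI[of _ D] exI[of _ K] exI[of _ j]) auto
next
  case True
  then obtain xs ys where split: "u # p = xs @ v # ys" by (meson split_list)
  then obtain Q' D' K' where "ascent (v # ys) Q' D' K'" "K' \<le> K"
    using ascent_suffix[of "v # xs" v ys Q D K] assms(1) by auto
  moreover have "distinct (v # ys)" "last (v # ys) = last (u # p)"
    using assms(2) unfolding split by auto
  ultimately show ?thesis unfolding reached_def using assms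
    by (intro exI[of _ ys] exI[of _ Q'] exI[of _ D'] exI[of _ K'] exI[of _ j]) auto
qed

lemma beneath_reached: "beneath k u \<Longrightarrow> reached k u"
proof (induction rule: beneath.induct)
  case (beneath_spine w k)
  then have "ascent [w] {} 0 0" by (intro ascent_start spine_point_lattice)
  then show ?case unfolding reached_def using beneath_spine
    by (intro exI[of _ "[]"] exI[of _ "{}"] exI[of _ 0] exI[of _ k]) auto
next
  case (beneath_down k u v)
  then obtain p Q D K j where p: "ascent (u # p) Q D K" "distinct (u # p)"
    "spine_point (last (u # p))" "last (u # p) d = 2 * j" "j + int K \<le> k"
    unfolding reached_def by blast
  show ?case
    by (rule reached_extend[OF ascent_down[OF p(1) beneath_down(2-4)] p(2-5)])
next
  case (beneath_closed k u)
  then obtain p Q D K j where p: "ascent (u # p) Q D K" "distinct (u # p)"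
    "spine_point (last (u # p))" "last (u # p) d = 2 * j" "j + int K \<le> k"
    unfolding reached_def by blast
  show ?case
    by (rule reached_extend[OF ascent_closed[OF p(1) beneath_closed(2)] p(2-5)])
next
  case (beneath_next k u)
  then obtain p Q D K j where p: "ascent (u # p) Q D K" "distinct (u # p)"
    "spine_point (last (u # p))" "last (u # p) d = 2 * j" "j + int K \<le> k"
    unfolding reached_def by blast
  then have "j + int (K + 1) \<le> k + 1" by simp
  from reached_extend[OF ascent_next[OF p(1)] p(2-4) this] show ?case .
qed

text \<open>
  A path without repetitions from a spine point at height \<open>2j\<close> to height \<open>2k + 1\<close> changes layer at
  most \<open>k - j\<close> times, so comparing heights gives \<open>card Q \<ge> K + D + 1\<close>. Hence the path, read
  backwards and preceded by the step from \<open>v\<close> to its end, has at most \<open>2 * card Q\<close> steps, and \<open>Q\<close>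
  is an obstacle at \<open>v\<close>.
\<close>

lemma not_beneath_over_spine:
  assumes "spine_point v" "v d = 2 * k"
  shows "\<not> beneath k (add_unit d v)"
proof
  assume "beneath k (add_unit d v)"
  then obtain p Q D K j where p: "ascent (add_unit d v # p) Q D K" "distinct (add_unit d v # p)"
    "last (add_unit d v # p) d = 2 * j" "j + int K \<le> k"
    using beneath_reached unfolding reached_def by blast
  from ascent_distinct[OF p(1,2)] obtain e where Q: "Q \<subseteq> Cl"
    and height: "add_unit d v d - 2 * j = int (card Q) + int K - int D"
    and e: "visits d (add_unit d v) (card Q + K + D) Q e"
    using p(3) by auto
  have "int K + int D + 1 \<le> int (card Q)"
    using height p(4) assms(2) by (simp add: add_unit_def)
  then have count: "card Q + K + D + 1 \<le> 2 * card Q" "Q \<noteq> {}" by auto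
  have "visits d v (Suc (card Q + K + D)) Q e"
    using visits_step[OF spine_point_lattice[OF assms(1)] near_add_unit e, of Q] by auto
  then have "visits d v (2 * card Q) Q e"
    by (rule visits_longer) (use count in simp)
  then have "obstacle v Q" unfolding obstacle_def using Q count by blast
  then show False using spine_point_no_obstacle assms(1) by blast
qed

lemma beneath_lattice: "beneath k u \<Longrightarrow> u \<in> int_lattice d"
  by (induction rule: beneath.induct) (auto intro: spine_point_lattice)

lemma beneath_cone:
  assumes "beneath k u" "v \<in> int_lattice d" "cone d u v"
  shows "beneath k v"
proof -
  define m where "m = nat (u d - v d)"
  have "near d m u v" "v d = u d - int m"
    using cone_near[OF assms(3)] cone_le[OF assms(3)] unfolding m_def by auto
  with assms(1) show ?thesis
  proof (induction m arbitrary: u)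
    case 0
    then show ?case using near_0_eq[OF beneath_lattice assms(2)] by auto
  next
    case (Suc m)
    let ?w = "(step_towards d u v)(d := u d - 1)"
    have "beneath k ?w"
    proof (rule beneath_down[OF Suc.prems(1)])
      show "?w \<in> int_lattice d" using d_index(2) by simp
      show "near d 1 u ?w" using near_step_towards[of d u v] by (auto simp: near_def)
    qed simp
    moreover have "near d m ?w v"
      using step_towards_near[OF Suc.prems(2)] Suc.prems(3) by (auto simp: near_def)
    moreover have "v d = ?w d - int m"
      using Suc.prems(3) by simp
    ultimately show ?case by (rule Suc.IH)
  qed
qed

definition layer_point :: "int \<Rightarrow> (nat \<Rightarrow> int) \<Rightarrow> bool" where
  "layer_point k x \<longleftrightarrow> beneath k x \<and> \<not> beneath k (add_unit d x)"

lemma layer_point_lattice: "layer_point k x \<Longrightarrow> x \<in> int_lattice d"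
  unfolding layer_point_def using beneath_lattice by blast

lemma layer_point_open: "layer_point k x \<Longrightarrow> x \<notin> Cl"
  unfolding layer_point_def using beneath_closed by blast

lemma layer_point_spine: "spine_point w \<Longrightarrow> w d = 2 * k \<Longrightarrow> layer_point k w"
  unfolding layer_point_def using beneath_spine not_beneath_over_spine by blast

text \<open>
  Compare with the spine point \<open>w\<close> of height \<open>2k\<close> with the same remaining coordinates: the cone below
  \<open>w\<close> reaches the given column, and a point of the column that is too high has the point above
  \<open>w\<close> in its cone.
\<close>

lemma layer_exists:
  assumes z: "z \<in> int_lattice d"
  shows "\<exists>h. layer_point k (z(d := h))"
proof -
  define w where "w = spine (z(d := 2 * k))"
  define m where "m = \<bar>w 1 - z 1\<bar>"
  have w: "spine_point w" "w d = 2 * k"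
    using z d_index(2,3) unfolding w_def by (auto intro: spine_point_spine)
  have wz: "\<bar>w i - z i\<bar> \<le> m" if "i \<noteq> d" for i
    using that unfolding w_def m_def by (cases "i = 1") auto
  have m: "0 \<le> m" by (simp add: m_def)
  have low: "beneath k (z(d := 2 * k - m))"
  proof (rule beneath_cone[OF beneath_spine[OF w]])
    show "z(d := 2 * k - m) \<in> int_lattice d" using z d_index(2) by simp
    show "cone d w (z(d := 2 * k - m))" using wz w(2) m by (auto simp: cone_def)
  qed
  have high: "\<not> beneath k (z(d := 2 * k + 1 + m))"
  proof
    assume "beneath k (z(d := 2 * k + 1 + m))"
    then have "beneath k (add_unit d w)"
    proof (rule beneath_cone)
      show "add_unit d w \<in> int_lattice d" using spine_point_lattice[OF w(1)] by simp
      show "cone d (z(d := 2 * k + 1 + m)) (add_unit d w)"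
        using wz w(2) m by (auto simp: cone_def add_unit_def abs_minus_commute)
    qed
    then show False using not_beneath_over_spine w by blast
  qed
  from int_last_true[of "\<lambda>h. beneath k (z(d := h))", OF low high] m show ?thesis
    unfolding layer_point_def add_unit_def by simp
qed

lemma layer_lipschitz:
  assumes "layer_point k x" "layer_point k y" "0 \<le> m"
    and near: "\<And>i. i \<in> {1..d} \<Longrightarrow> i \<noteq> d \<Longrightarrow> \<bar>x i - y i\<bar> \<le> m"
  shows "\<bar>x d - y d\<bar> \<le> m"
proof (rule cone_closed_top_lipschitz[of "beneath k"])
  show "beneath k x \<and> \<not> beneath k (add_unit d x)" "beneath k y \<and> \<not> beneath k (add_unit d y)"
    using assms(1,2) unfolding layer_point_def by blast+
qed (fact beneath_cone layer_point_lattice[OF assms(1)] layer_point_lattice[OF assms(2)]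
    d_index(2) assms(3) near)+

lemma beneath_higher:
  assumes "beneath k x" "k \<le> k'"
  shows "beneath k' (x(d := x d + (k' - k)))"
  using assms(2)
proof (induction k' rule: int_ge_induct)
  case (step k')
  have eq: "add_unit d (x(d := x d + (k' - k))) = x(d := x d + (k' + 1 - k))"
    by (rule ext) (simp add: add_unit_def)
  show ?case using beneath_next[OF step.IH] by (simp only: eq)
qed (use assms(1) in simp)

lemma layers_ordered:
  assumes "layer_point k x" "layer_point k' y" "k < k'"
    and same: "\<And>i. i \<in> {1..d} \<Longrightarrow> i \<noteq> d \<Longrightarrow> x i = y i"
  shows "x d < y d"
proof -
  have x': "beneath k' (x(d := x d + (k' - k)))"
    using assms(1,3) beneath_higher by (simp add: layer_point_def)
  have y: "\<not> beneath k' (add_unit d y)" "y \<in> int_lattice d"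
    using assms(2) layer_point_lattice[OF assms(2)] by (simp_all add: layer_point_def)
  have "(x(d := x d + (k' - k))) d \<le> y d + 0"
    by (rule cone_closed_top_le[of "beneath k'", OF beneath_cone x' y d_index(2)])
      (use same in simp_all)
  then show ?thesis using assms(3) by simp
qed

section \<open>The embedding\<close>

text \<open>
  The hyperplane \<open>z\<^sub>1 = 0\<close> has to land on the spine at height \<open>2 * z d\<close>, so each line in the
  first direction is shifted by the first coordinate of the spine there.
\<close>

definition spine_shift :: "(nat \<Rightarrow> int) \<Rightarrow> int" where
  "spine_shift z = spine (z(d := 2 * z d)) 1"

definition comb_map :: "(nat \<Rightarrow> int) \<Rightarrow> nat \<Rightarrow> int" where
  "comb_map z = (let x = z(1 := z 1 + spine_shift z)
     in x(d := (SOME h. layer_point (z d) (x(d := h)))))"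

lemma comb_map_layer:
  assumes "z \<in> int_lattice d"
  shows "layer_point (z d) (comb_map z)"
  unfolding comb_map_def Let_def
  by (rule someI_ex[OF layer_exists]) (use assms d_index(1) in simp)

lemma comb_map_1: "comb_map z 1 = z 1 + spine_shift z"
  using d_index(3) by (simp add: comb_map_def Let_def)

lemma comb_map_other: "i \<noteq> 1 \<Longrightarrow> i \<noteq> d \<Longrightarrow> comb_map z i = z i"
  by (simp add: comb_map_def Let_def)

lemma spine_at:
  assumes "z \<in> int_lattice d"
  shows "spine_point (spine (z(d := 2 * z d)))" "spine (z(d := 2 * z d)) d = 2 * z d"
  using assms d_index(2,3) by (auto intro: spine_point_spine)

lemma spine_shift_lipschitz:
  assumes "z \<in> int_lattice d" "z' \<in> int_lattice d" "0 \<le> m"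
    and "\<And>i. i \<noteq> 1 \<Longrightarrow> i \<noteq> d \<Longrightarrow> \<bar>z i - z' i\<bar> \<le> m" "2 * \<bar>z d - z' d\<bar> \<le> m"
  shows "\<bar>spine_shift z - spine_shift z'\<bar> \<le> m"
  unfolding spine_shift_def
proof (rule spine_lipschitz[OF spine_at(1) spine_at(1)])
  fix i assume "i \<in> {1..d}" "i \<noteq> 1"
  moreover have "\<bar>2 * z d - 2 * z' d\<bar> \<le> m" using assms(5)
    by (simp only: right_diff_distrib[symmetric] abs_mult abs_numeral)
  ultimately show "\<bar>spine (z(d := 2 * z d)) i - spine (z'(d := 2 * z' d)) i\<bar> \<le> m"
    using assms(4)[of i] by (cases "i = d") auto
qed (use assms in auto)

text \<open>
  The spine point lies in layer \<open>z d\<close>, and a layer has only one point in each column.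
\<close>

lemma comb_map_spine:
  assumes z: "z \<in> int_lattice d" "z 1 = 0"
  shows "comb_map z = spine (z(d := 2 * z d))" (is "_ = ?w")
proof -
  have same: "comb_map z i = ?w i" if "i \<noteq> d" for i
    using that z(2) comb_map_1[of z] comb_map_other[of i z]
    by (cases "i = 1") (auto simp: spine_shift_def)
  have "\<bar>comb_map z d - ?w d\<bar> \<le> 0"
  proof (rule layer_lipschitz[OF comb_map_layer[OF z(1)] layer_point_spine[OF spine_at[OF z(1)]]])
    show "\<bar>comb_map z i - ?w i\<bar> \<le> 0" if "i \<noteq> d" for i
      using same[OF that] by linarith
  qed simp
  then have last: "comb_map z d = ?w d" by linarith
  have "comb_map z i = ?w i" for i
    by (cases "i = d") (metis last, rule same)
  then show ?thesis by (rule ext)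
qed

text \<open>
  A column meets different layers at different heights, so the image determines \<open>z d\<close>; then it
  determines the shift, and with it \<open>z 1\<close>.
\<close>

lemma comb_map_inj: "inj_on comb_map (int_lattice d)"
proof (rule inj_onI)
  fix z z' assume z: "z \<in> int_lattice d" "z' \<in> int_lattice d" and eq: "comb_map z = comb_map z'"
  have other: "z i = z' i" if "i \<noteq> 1" "i \<noteq> d" for i
    using comb_map_other[OF that] eq by metis
  have last: "z d = z' d"
    using layers_ordered[OF comb_map_layer[OF z(1)] comb_map_layer[OF z(2)]]
      layers_ordered[OF comb_map_layer[OF z(2)] comb_map_layer[OF z(1)]] eq
    by (metis less_irrefl linorder_less_linear)
  have "\<bar>spine_shift z - spine_shift z'\<bar> \<le> 0"
    by (rule spine_shift_lipschitz[OF z]) (use other last in auto)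
  then have "z 1 = z' 1" using eq comb_map_1[of z] comb_map_1[of z'] by simp
  then show "z = z'" using other last by (metis ext)
qed

lemma comb_map_layer_edge:
  assumes z: "z \<in> int_lattice d" and i: "1 \<le> i" "i < d"
  shows "near d 2 (comb_map z) (comb_map (add_unit i z))"
proof -
  let ?z = "add_unit i z"
  have z': "?z \<in> int_lattice d" using z i by simp
  have zd: "?z d = z d" using i by (simp add: add_unit_def)
  have "\<bar>spine_shift z - spine_shift ?z\<bar> \<le> (if i = 1 then 0 else 1)"
    by (rule spine_shift_lipschitz[OF z z']) (use zd in \<open>auto simp: add_unit_def\<close>)
  then have one: "\<bar>comb_map z 1 - comb_map ?z 1\<bar> \<le> 1"
    unfolding comb_map_1 by (auto simp: add_unit_def split: if_splits)
  have other: "\<bar>comb_map z j - comb_map ?z j\<bar> \<le> 1" if "j \<noteq> d" for j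
    using that one comb_map_other[of j] by (cases "j = 1") (auto simp: add_unit_def)
  have "\<bar>comb_map z d - comb_map ?z d\<bar> \<le> 1"
    by (rule layer_lipschitz[OF comb_map_layer[OF z] comb_map_layer[OF z', unfolded zd]])
      (simp_all add: other)
  then have "near d 1 (comb_map z) (comb_map ?z)"
    unfolding near_def using other by fastforce
  then show ?thesis by (rule near_mono) simp
qed

text \<open>
  Here distance 2 is used up: spine points of successive layers differ by 2 in height, which
  also allows a difference of 2 in the first coordinate.
\<close>

lemma comb_map_spine_edge:
  assumes z: "z \<in> int_lattice d" "z 1 = 0"
  shows "near d 2 (comb_map z) (comb_map (add_unit d z))"
proof -
  let ?z = "add_unit d z"
  have z': "?z \<in> int_lattice d" using z by simp
  have z1: "?z 1 = 0" using z d_index(3) by (simp add: add_unit_def)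
  have shift: "\<bar>spine_shift z - spine_shift ?z\<bar> \<le> 2"
    by (rule spine_shift_lipschitz[OF z(1) z']) (auto simp: add_unit_def)
  have "\<bar>comb_map z j - comb_map ?z j\<bar> \<le> 2" for j
  proof (cases "j = 1")
    case True
    then show ?thesis using shift z(2) z1 comb_map_1 by simp
  next
    case False
    then show ?thesis
      unfolding comb_map_spine[OF z] comb_map_spine[OF z' z1] by (auto simp: add_unit_def)
  qed
  then show ?thesis by (simp add: near_def)
qed

lemma spread_out_edgeI:
  assumes "u \<in> int_lattice d" "v \<in> int_lattice d" "u \<noteq> v" "near d M u v"
  shows "{u, v} \<in> edges (spread_out_lattice d M)"
proof -
  have ne: "{1..d} \<noteq> {}" using d_index(1) by blast
  obtain i where i: "i \<in> {1..d}" "u i \<noteq> v i"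
    using lattice_eqI[OF assms(1,2)] assms(3) by blast
  have "0 < linf_dist d u v"
    unfolding linf_dist_def using i ne by (subst Max_gr_iff) auto
  moreover have "linf_dist d u v \<le> int M"
    unfolding linf_dist_def using assms(4) ne by (subst Max_le_iff) (auto simp: near_def)
  ultimately show ?thesis unfolding spread_out_lattice_def using assms(1,2) by auto
qed

theorem comb_embedding:
  "graph_embedding (comb_graph d) (spread_out_lattice d 2) (int_lattice d - Cl) comb_map"
  unfolding graph_embedding_def
proof (intro conjI ballI impI)
  show "inj_on comb_map (verts (comb_graph d))"
    using comb_map_inj by (simp add: comb_graph_def)
  show "comb_map ` verts (comb_graph d) \<subseteq> int_lattice d - Cl"
    using comb_map_layer layer_point_lattice layer_point_open by (fastforce simp: comb_graph_def)
  have edge: "{comb_map z, comb_map (add_unit i z)} \<in> edges (spread_out_lattice d 2)"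
    if z: "z \<in> int_lattice d" and i: "1 \<le> i \<and> i < d \<or> i = d \<and> z 1 = 0" for z i
  proof -
    have z': "add_unit i z \<in> int_lattice d" using z i d_index(2) by auto
    have "z i \<noteq> add_unit i z i" by (simp add: add_unit_def)
    then have "z \<noteq> add_unit i z" by metis
    then have "comb_map z \<noteq> comb_map (add_unit i z)"
      using inj_onD[OF comb_map_inj _ z z'] by blast
    moreover have "near d 2 (comb_map z) (comb_map (add_unit i z))"
      using i comb_map_layer_edge[OF z] comb_map_spine_edge[OF z] by blast
    ultimately show ?thesis
      by (intro spread_out_edgeI layer_point_lattice[OF comb_map_layer] z z')
  qed
  fix u v assume "{u, v} \<in> edges (comb_graph d)"
  then obtain z i where z: "z \<in> int_lattice d" "1 \<le> i \<and> i < d \<or> i = d \<and> z 1 = 0"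
    and uv: "{u, v} = {z, add_unit i z}"
    unfolding comb_graph_def by auto
  have "{comb_map u, comb_map v} = {comb_map z, comb_map (add_unit i z)}"
    using uv by (metis image_empty image_insert)
  then show "{comb_map u, comb_map v} \<in> edges (spread_out_lattice d 2)"
    using edge[OF z] by simp
qed

end

section \<open>Probability estimates\<close>

lemma spread_out_verts [simp]: "verts (spread_out_lattice d M) = int_lattice d"
  by (simp add: spread_out_lattice_def)

abbreviation bernoulli_sites :: "'b set \<Rightarrow> real \<Rightarrow> ('b \<Rightarrow> bool) measure" where
  "bernoulli_sites V p \<equiv> \<Pi>\<^sub>M v\<in>V. measure_pmf (bernoulli_pmf p)"

lemma bernoulli_all_closed:
  assumes "finite Q" "Q \<subseteq> V" "0 \<le> p" "p \<le> 1"
  shows "{\<omega> \<in> space (bernoulli_sites V p). \<forall>v\<in>Q. \<not> \<omega> v} \<in> sets (bernoulli_sites V p)"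
    and "measure (bernoulli_sites V p) {\<omega> \<in> space (bernoulli_sites V p). \<forall>v\<in>Q. \<not> \<omega> v}
      = (1 - p) ^ card Q"
proof -
  let ?M = "bernoulli_sites V p"
  interpret product_prob_space "\<lambda>_. measure_pmf (bernoulli_pmf p)" V
    by (intro product_prob_spaceI measure_pmf.prob_space_axioms)
  have eq: "{\<omega> \<in> space ?M. \<forall>v\<in>Q. \<not> \<omega> v} =
      prod_emb V (\<lambda>_. measure_pmf (bernoulli_pmf p)) Q (\<Pi>\<^sub>E v\<in>Q. {False})"
    by (auto simp only: prod_emb_def vimage_eq restrict_PiE_iff space_PiM mem_Collect_eq
        Int_iff singleton_iff)
  show "{\<omega> \<in> space ?M. \<forall>v\<in>Q. \<not> \<omega> v} \<in> sets ?M"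
    unfolding eq using assms by (intro sets_PiM_I) auto
  have "measure ?M {\<omega> \<in> space ?M. \<forall>v\<in>Q. \<not> \<omega> v} = (\<Prod>v\<in>Q. measure (bernoulli_pmf p) {False})"
    unfolding eq using assms by (intro measure_PiM_emb) auto
  then show "measure ?M {\<omega> \<in> space ?M. \<forall>v\<in>Q. \<not> \<omega> v} = (1 - p) ^ card Q"
    using assms by (simp add: measure_pmf_single)
qed

text \<open>
  The event that some walk of \<open>C * m\<close> steps from \<open>v\<close> visits \<open>m\<close> closed sites, up to replacing the sets
  visited by such walks by the finite family \<open>visitable\<close>, which makes it a finite union.
\<close>

definition visited_closed :: "nat \<Rightarrow> real \<Rightarrow> nat \<Rightarrow> nat \<Rightarrow> (nat \<Rightarrow> int) \<Rightarrow> ((nat \<Rightarrow> int) \<Rightarrow> bool) set" where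
  "visited_closed d p C m v =
    (\<Union>Q\<in>{Q \<in> visitable d (C * m) v. card Q = m \<and> finite Q \<and> Q \<subseteq> int_lattice d}.
      {\<omega> \<in> space (bernoulli_sites (int_lattice d) p). \<forall>u\<in>Q. \<not> \<omega> u})"

lemma visited_closed_bound:
  assumes "0 \<le> p" "p \<le> 1"
  shows "visited_closed d p C m v \<in> sets (bernoulli_sites (int_lattice d) p)"
    and "measure (bernoulli_sites (int_lattice d) p) (visited_closed d p C m v)
      \<le> 2 * ((2 * 3 ^ d) ^ C * (1 - p)) ^ m"
proof -
  let ?M = "bernoulli_sites (int_lattice d) p"
  interpret product_prob_space "\<lambda>_. measure_pmf (bernoulli_pmf p)" "int_lattice d"
    by (intro product_prob_spaceI measure_pmf.prob_space_axioms)
  define F where "F = {Q \<in> visitable d (C * m) v. card Q = m \<and> finite Q \<and> Q \<subseteq> int_lattice d}"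
  define A where "A Q = {\<omega> \<in> space ?M. \<forall>u\<in>Q. \<not> \<omega> u}" for Q
  have eq: "visited_closed d p C m v = (\<Union>Q\<in>F. A Q)"
    unfolding visited_closed_def F_def A_def ..
  have F: "finite F" "card F \<le> 2 * (2 * 3 ^ d) ^ (C * m)"
    using card_visitable[of d "C * m" v] unfolding F_def
    by (auto intro: order_trans[OF card_mono])
  have A: "A Q \<in> sets ?M" "measure ?M (A Q) = (1 - p) ^ m" if "Q \<in> F" for Q
    using that bernoulli_all_closed[OF _ _ assms, of Q "int_lattice d"] unfolding F_def A_def by auto
  show "visited_closed d p C m v \<in> sets ?M"
    unfolding eq using F(1) A(1) by (intro sets.finite_UN) auto
  have "measure ?M (\<Union>Q\<in>F. A Q) \<le> (\<Sum>Q\<in>F. measure ?M (A Q))"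
    using F(1) A(1) by (intro P.finite_measure_subadditive_finite) auto
  also have "\<dots> = real (card F) * (1 - p) ^ m"
    using A(2) by simp
  also have "\<dots> \<le> real (2 * (2 * 3 ^ d) ^ (C * m)) * (1 - p) ^ m"
    using F(2) assms by (intro mult_right_mono) (simp_all only: of_nat_le_iff, simp)
  also have "\<dots> = 2 * ((2 * 3 ^ d) ^ C * (1 - p)) ^ m"
    by (simp add: power_mult power_mult_distrib)
  finally show "measure ?M (visited_closed d p C m v) \<le> 2 * ((2 * 3 ^ d) ^ C * (1 - p)) ^ m"
    unfolding eq .
qed

text \<open>
  The starting point may depend on \<open>t\<close>. For fixed \<open>t\<close> the probabilities of the events with \<open>m \<ge> t\<close>
  add up to at most \<open>4 \<cdot> 2\<^bsup>-t\<^esup>\<close>, so almost surely not all \<open>t\<close> fail.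
\<close>

lemma few_closed_AE:
  assumes p: "0 \<le> p" "p \<le> 1" and small: "(2 * 3 ^ d) ^ C * (1 - p) \<le> 1 / 2"
  shows "AE \<omega> in bernoulli_sites (int_lattice d) p. \<exists>t. \<forall>m\<ge>t. \<omega> \<notin> visited_closed d p C m (v t)"
proof -
  let ?M = "bernoulli_sites (int_lattice d) p"
  interpret product_prob_space "\<lambda>_. measure_pmf (bernoulli_pmf p)" "int_lattice d"
    by (intro product_prob_spaceI measure_pmf.prob_space_axioms)
  define E where "E t = (\<Union>i. visited_closed d p C (t + i) (v t))" for t
  have E_sets: "E t \<in> sets ?M" for t
    unfolding E_def using visited_closed_bound(1)[OF p] by blast
  have bound: "measure ?M (visited_closed d p C (t + i) (v t)) \<le> 2 * (1/2) ^ t * (1/2) ^ i" for t i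
  proof -
    have "measure ?M (visited_closed d p C (t + i) (v t)) \<le> 2 * ((2 * 3 ^ d) ^ C * (1 - p)) ^ (t + i)"
      by (rule visited_closed_bound(2)[OF p])
    also have "\<dots> \<le> 2 * (1/2) ^ (t + i)"
      using p small by (intro mult_left_mono power_mono) auto
    finally show ?thesis by (simp add: power_add)
  qed
  have geom: "(\<lambda>i. 2 * (1/2) ^ t * (1/2::real) ^ i) sums (2 * (1/2) ^ t * 2)" for t :: nat
    using geometric_sums[of "1/2 :: real"] by (intro sums_mult) simp
  have E_le: "measure ?M (E t) \<le> 4 * (1/2) ^ t" for t
  proof -
    have summable: "summable (\<lambda>i. measure ?M (visited_closed d p C (t + i) (v t)))"
      by (rule summable_comparison_test'[OF sums_summable[OF geom[of t]], of 0])
        (use bound[of t] in simp)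
    have "measure ?M (E t) \<le> (\<Sum>i. measure ?M (visited_closed d p C (t + i) (v t)))"
      unfolding E_def using visited_closed_bound(1)[OF p] summable
      by (intro P.finite_measure_subadditive_countably) auto
    also have "\<dots> \<le> (\<Sum>i. 2 * (1/2) ^ t * (1/2) ^ i)"
      by (rule suminf_le[OF bound summable sums_summable[OF geom]])
    also have "\<dots> = 4 * (1/2) ^ t"
      using sums_unique[OF geom[of t]] by simp
    finally show ?thesis .
  qed
  have inter: "(\<Inter>t. E t) \<in> sets ?M" using E_sets by (intro sets.countable_INT') auto
  have "measure ?M (\<Inter>t. E t) \<le> 4 * (1/2) ^ t" for t
    using P.finite_measure_mono[of "\<Inter>t. E t" "E t"] E_sets E_le[of t] by fastforce
  moreover have "(\<lambda>t. 4 * (1/2::real) ^ t) \<longlonglongrightarrow> 4 * 0"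
    by (intro tendsto_mult LIMSEQ_realpow_zero tendsto_const) auto
  ultimately have "measure ?M (\<Inter>t. E t) \<le> 0"
    using LIMSEQ_le_const[of "\<lambda>t. 4 * (1/2::real) ^ t" "4 * 0" "measure ?M (\<Inter>t. E t)"] by simp
  then have "measure ?M (\<Inter>t. E t) = 0"
    using measure_nonneg[of ?M] by (intro antisym)
  then have "(\<Inter>t. E t) \<in> null_sets ?M"
    using inter by (simp add: null_sets_def P.emeasure_eq_measure)
  then show ?thesis
  proof (rule AE_I')
    show "{\<omega> \<in> space ?M. \<not> (\<exists>t. \<forall>m\<ge>t. \<omega> \<notin> visited_closed d p C m (v t))} \<subseteq> (\<Inter>t. E t)"
      unfolding E_def by (auto simp: le_iff_add)
  qed
qed

text \<open>
  If the point \<open>v\<close> with first coordinate \<open>36 t\<close> on the first axis were pushed, \<open>pushed_visits\<close> would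
  give a walk from it with \<open>m \<ge> t\<close> closed sites and at most \<open>36 m\<close> steps.
\<close>

lemma comb_embeds_if_few_closed:
  assumes d: "2 \<le> d" and \<omega>: "\<omega> \<in> space (bernoulli_sites (int_lattice d) p)"
    and few: "\<forall>m\<ge>t. \<omega> \<notin> visited_closed d p 36 m (\<lambda>i\<in>{1..d}. if i = 1 then 36 * int t else 0)"
  shows "\<exists>f. graph_embedding (comb_graph d) (spread_out_lattice d 2)
           (open_set (spread_out_lattice d 2) \<omega>) f"
proof -
  define v :: "nat \<Rightarrow> int" where "v = (\<lambda>i\<in>{1..d}. if i = 1 then 36 * int t else 0)"
  define Cl where "Cl = {u \<in> int_lattice d. \<not> \<omega> u}"
  interpret closed_sites d Cl by standard (rule d)
  have v: "v \<in> int_lattice d" by (simp add: v_def int_lattice_def)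
  have v1: "v 1 = 36 * int t" using d by (simp add: v_def)
  have "\<not> pushed v"
  proof
    assume "pushed v"
    then obtain Q l e where Q: "visits d v l Q e" "Q \<subseteq> Cl" "int l + v 1 \<le> 36 * int (card Q)"
      using pushed_visits by blast
    have "l \<le> 36 * card Q" and t: "t \<le> card Q" using Q(3) v1 by linarith+
    then have "visits d v (36 * card Q) Q e" using visits_longer[OF Q(1)] by blast
    then have "Q \<in> visitable d (36 * card Q) v" using visits_visitable by blast
    then have "\<omega> \<in> visited_closed d p 36 (card Q) v"
      unfolding visited_closed_def using Q(2) \<omega> visits_finite[OF Q(1)] by (auto simp: Cl_def)
    then show False using few t unfolding v_def by blast
  qed
  with v have "\<exists>u\<in>int_lattice d. \<not> pushed u" by blast
  then interpret bounded_push d Cl by unfold_locales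
  have "int_lattice d - Cl = open_set (spread_out_lattice d 2) \<omega>"
    by (auto simp: Cl_def open_set_def)
  then show ?thesis using comb_embedding by auto
qed

theorem theorem1:
  fixes d :: nat
  assumes "d \<ge> 2"
  shows "critical_prob (comb_graph d) (spread_out_lattice d 2) < 1"
proof -
  \<comment> \<open>\<open>B\<close> is the growth rate of the number of candidate sets per closed site.\<close>
  define B :: real where "B = (2 * 3 ^ d) ^ 36"
  \<comment> \<open>Then the union bound for \<open>m\<close> closed sites is \<open>2 \<cdot> 2\<^bsup>-m\<^esup>\<close>.\<close>
  define p where "p = 1 - 1 / (2 * B)"
  have B: "1 \<le> B" unfolding B_def by (intro one_le_power) (simp add: order_trans[of 1 "2::real"])
  have p: "0 \<le> p" "p \<le> 1" "p < 1" and small: "B * (1 - p) \<le> 1 / 2"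
    using B by (simp_all add: p_def field_simps)
  let ?M = "bernoulli_sites (int_lattice d) p"
  let ?S = "site_percolation (spread_out_lattice d 2) p"
  let ?P = "\<lambda>\<omega>. \<exists>f. graph_embedding (comb_graph d) (spread_out_lattice d 2)
              (open_set (spread_out_lattice d 2) \<omega>) f"
  interpret product_prob_space "\<lambda>_. measure_pmf (bernoulli_pmf p)" "int_lattice d"
    by (intro product_prob_spaceI measure_pmf.prob_space_axioms)
  have S: "?S = completion ?M" by (simp add: site_percolation_def)
  interpret S: prob_space ?S unfolding S by (rule P.prob_space_completion)
  have "AE \<omega> in ?M. ?P \<omega>"
    using few_closed_AE[OF p(1,2) small[unfolded B_def],
        of "\<lambda>t. \<lambda>i\<in>{1..d}. if i = 1 then 36 * int t else 0"] AE_space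
  proof eventually_elim
    case (elim \<omega>)
    then show ?case using comb_embeds_if_few_closed[OF assms] by blast
  qed
  then have AE: "AE \<omega> in ?S. ?P \<omega>" unfolding S by (rule AE_completion)
  \<comment> \<open>The event is measurable for the completion because its complement is contained in a null set.\<close>
  have "Measurable.pred ?S (\<lambda>\<omega>. \<not> ?P \<omega>)"
    using \<open>AE \<omega> in ?M. ?P \<omega>\<close> unfolding S by (intro sets_completion_AE) simp
  then have "{\<omega> \<in> space ?S. \<not> ?P \<omega>} \<in> sets ?S" by (simp add: pred_def)
  from sets.sets_Collect_neg[OF this] have "{\<omega> \<in> space ?S. ?P \<omega>} \<in> sets ?S"
    by (simp only: not_not)
  then have "embedding_prob (comb_graph d) (spread_out_lattice d 2) p = 1"
    unfolding embedding_prob_def using AE by (subst S.prob_Collect_eq_1) simp_all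
  then have "critical_prob (comb_graph d) (spread_out_lattice d 2) \<le> ereal p"
    unfolding critical_prob_def using p by (intro INF_lower) auto
  also have "\<dots> < 1" using p(3) by simp
  finally show ?thesis .
qed

end
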